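(* Let $d\ge2$. If the collection of all convex bodies in $\mathbb{R}^{d-1}$ has infinite VC dimension, then there is a norm on $\mathbb{R}^d$ whose collection of closed balls has infinite VC dimension.
   Context: A convex body in $\mathbb{R}^k$ is a closed, bounded, convex subset with nonempty interior. A finite set $S$ is shattered by a collection $\mathscr{C}$ if for every $A\subset S$ there is $K\in\mathscr{C}$ with $S\cap K=A$; the VC dimension of $\mathscr{C}$ is the supremum of cardinalities of finite sets shattered by $\mathscr{C}$. *)

theory Defs
  imports "HOL-Analysis.Analysis" "HOL-Library.Extended_Nat"
begin

definition convex_body :: "'a::euclidean_space set \<Rightarrow> bool" where
  "convex_body K \<longleftrightarrow> closed K \<and> bounded K \<and> convex K \<and> interior K \<noteq> {}"

definition shatters :: "'a set set \<Rightarrow> 'a set \<Rightarrow> bool" where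
  "shatters \<C> S \<longleftrightarrow> (\<forall>A. A \<subseteq> S \<longrightarrow> (\<exists>K\<in>\<C>. S \<inter> K = A))"

(* The supremum is taken in the extended naturals, so infinite VC dimension is the value \<infinity>. *)
definition vc_dim :: "'a set set \<Rightarrow> enat" where
  "vc_dim \<C> = (SUP S \<in> {S. finite S \<and> shatters \<C> S}. enat (card S))"

(* The type class constant norm is one fixed function on each type; arbitrary norms
   on a vector space are therefore functions satisfying this predicate. *)
definition is_norm :: "('a::real_vector \<Rightarrow> real) \<Rightarrow> bool" where
  "is_norm N \<longleftrightarrow>
     (\<forall>x. 0 \<le> N x) \<and> (\<forall>x. N x = 0 \<longleftrightarrow> x = 0) \<and>
     (\<forall>a x. N (a *\<^sub>R x) = \<bar>a\<bar> * N x) \<and> (\<forall>x y. N (x + y) \<le> N x + N y)"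

definition norm_cball :: "('a::real_vector \<Rightarrow> real) \<Rightarrow> 'a \<Rightarrow> real \<Rightarrow> 'a set" where
  "norm_cball N c r = {x. N (x - c) \<le> r}"

(* Radii are strictly positive: singletons and the empty set do not count as balls. *)
definition norm_cballs :: "('a::real_vector \<Rightarrow> real) \<Rightarrow> 'a set set" where
  "norm_cballs N = {norm_cball N c r | c r. 0 < r}"

end

theory Submission
  imports Defs "HOL-Library.Nat_Bijection"
begin

text \<open>
  For \<open>d = 2\<close> the hypothesis fails, because convex subsets of a line cannot pick out the two
  outer points of three.  For \<open>d \<ge> 3\<close> a suitable norm always exists.  Let \<open>x\<^sub>0, x\<^sub>1, \<dots>\<close> be distinct
  points of a unit circle and let \<open>c\<^sub>m\<close> be points of the axis of the circle.  The Euclidean sphere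
  around \<open>c\<^sub>m\<close> through one \<open>x\<^sub>j\<close> passes through all of them.  Let \<open>A\<^sub>0, A\<^sub>1, \<dots>\<close> enumerate the finite sets of
  indices.  Shrink the Euclidean unit ball to the closed convex hull of a smaller ball and the
  directions \<open>\<plusminus>(x\<^sub>j - c\<^sub>m)\<close> with \<open>j \<in> A\<^sub>m\<close>.  All the directions \<open>x\<^sub>j - c\<^sub>m\<close> are isolated from each
  other, so those with \<open>j \<notin> A\<^sub>m\<close> lose their boundary points, and the ball around \<open>c\<^sub>m\<close> contains
  \<open>x\<^sub>j\<close> exactly when \<open>j \<in> A\<^sub>m\<close>.
\<close>

section \<open>Infinite VC dimension, and shattering on a line\<close>

lemma vc_dim_eq_infinityI:
  assumes "\<And>n. \<exists>S. finite S \<and> card S = n \<and> shatters \<C> S"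
  shows "vc_dim \<C> = \<infinity>"
proof (rule ccontr)
  assume "vc_dim \<C> \<noteq> \<infinity>"
  then obtain n where n: "vc_dim \<C> = enat n"
    by auto
  obtain S where S: "finite S" "card S = Suc n" "shatters \<C> S"
    using assms by blast
  have "enat (card S) \<le> vc_dim \<C>"
    unfolding vc_dim_def by (rule SUP_upper) (use S in auto)
  then show False
    using n S by simp
qed

lemma vc_dim_infinityD:
  assumes "vc_dim \<C> = \<infinity>"
  shows "\<exists>S. finite S \<and> n < card S \<and> shatters \<C> S"
proof -
  have "enat n < vc_dim \<C>"
    using assms by simp
  then show ?thesis
    unfolding vc_dim_def by (auto simp: less_SUP_iff)
qed

lemma shatters_convex_CARD_1:
  fixes S :: "(real ^ 'm) set"
  assumes "CARD('m) = 1" and "\<And>K. K \<in> \<C> \<Longrightarrow> convex K" and "shatters \<C> S" and "finite S"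
  shows "card S \<le> 2"
proof (rule ccontr)
  assume "\<not> card S \<le> 2"
  obtain i :: 'm where i: "UNIV = {i}"
    using assms(1) card_1_singletonE by blast
  have coord: "x = y" if "x $ i = y $ i" for x y :: "real ^ 'm"
    using that i by (metis UNIV_I singletonD vec_eq_iff)
  define f where "f = (\<lambda>x :: real ^ 'm. x $ i)"
  have inj: "inj_on f S"
    using coord by (auto simp: inj_on_def f_def)
  have fin: "finite (f ` S)" and card: "card (f ` S) = card S"
    using assms(4) inj by (auto simp: card_image)
  have ne: "f ` S \<noteq> {}"
    using card \<open>\<not> card S \<le> 2\<close> by auto
  define a b where "a = Min (f ` S)" and "b = Max (f ` S)"
  \<comment> \<open>More than two coordinate values occur, so one lies strictly between the extremes
    \<open>a\<close> and \<open>b\<close>.\<close>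
  have "card {a, b} \<le> 2"
    by (simp add: card_insert_if)
  then have "\<not> f ` S \<subseteq> {a, b}"
    using card \<open>\<not> card S \<le> 2\<close> by (metis card_mono finite.emptyI finite_insert le_trans)
  then obtain z where z: "z \<in> S" "f z \<noteq> a" "f z \<noteq> b"
    by auto
  obtain x y where xy: "x \<in> S" "f x = a" "y \<in> S" "f y = b"
    using Min_in[OF fin ne] Max_in[OF fin ne] unfolding a_def b_def by fastforce
  have "a \<le> f z" "f z \<le> b"
    using z fin by (auto simp: a_def b_def)
  then have less: "a < f z" "f z < b"
    using z by auto
  obtain K where K: "K \<in> \<C>" "S \<inter> K = {x, y}"
    using assms(3) xy unfolding shatters_def by (metis empty_subsetI insert_subset)
  define u where "u = (f z - a) / (b - a)"
  have u: "0 \<le> u" "u \<le> 1"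
    using less by (auto simp: u_def field_simps)
  have "f z = (1 - u) * a + u * b"
  proof -
    have "u * (b - a) = f z - a"
      using less by (simp add: u_def)
    then show ?thesis
      by (simp add: algebra_simps)
  qed
  then have "z = (1 - u) *\<^sub>R x + u *\<^sub>R y"
    using xy by (intro coord) (simp add: f_def)
  moreover have "x \<in> K" "y \<in> K"
    using K by auto
  ultimately have "z \<in> K"
    using convexD[OF assms(2)[OF K(1)], of x y "1 - u" u] u by simp
  then have "z \<in> {x, y}"
    using K z by blast
  then show False
    using z xy by auto
qed

section \<open>A norm with prescribed Euclidean unit directions\<close>

text \<open>The polar of the ball of radius \<open>1/2\<close> together with the points
  \<open>\<plusminus>g / norm g\<close>. The bound 2 keeps the supremum over it finite.\<close>

definition dual_functionals :: "'a::euclidean_space set \<Rightarrow> 'a set" where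
  "dual_functionals G = {p. norm p \<le> 2 \<and> (\<forall>g\<in>G. \<bar>p \<bullet> g\<bar> \<le> norm g)}"

text \<open>The unit ball of this norm is the closed convex hull of the ball of radius \<open>1/2\<close> and the
  points \<open>\<plusminus>g / norm g\<close> with \<open>g \<in> G\<close>, described here by its support functionals.\<close>

definition hull_norm :: "'a::euclidean_space set \<Rightarrow> 'a \<Rightarrow> real" where
  "hull_norm G v = (SUP p\<in>dual_functionals G. \<bar>p \<bullet> v\<bar>)"

lemma unit_in_dual_functionals:
  assumes "norm p \<le> 1"
  shows "p \<in> dual_functionals G"
proof -
  have "\<bar>p \<bullet> g\<bar> \<le> norm g" for g
    using Cauchy_Schwarz_ineq2[of p g] mult_right_mono[OF assms, of "norm g"] by simp
  then show ?thesis
    using assms by (simp add: dual_functionals_def)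
qed

lemma dual_functionals_nonempty: "dual_functionals G \<noteq> {}"
  using unit_in_dual_functionals[of 0 G] by auto

lemma hull_norm_upper:
  assumes "p \<in> dual_functionals G"
  shows "\<bar>p \<bullet> v\<bar> \<le> hull_norm G v"
  unfolding hull_norm_def
proof (rule cSUP_upper[OF assms])
  have "\<bar>q \<bullet> v\<bar> \<le> 2 * norm v" if "q \<in> dual_functionals G" for q
  proof -
    have "norm q * norm v \<le> 2 * norm v"
      using that by (intro mult_right_mono) (auto simp: dual_functionals_def)
    then show ?thesis
      using Cauchy_Schwarz_ineq2[of q v] by linarith
  qed
  then show "bdd_above ((\<lambda>p. \<bar>p \<bullet> v\<bar>) ` dual_functionals G)"
    by (rule bdd_aboveI2)
qed

lemma hull_norm_least:
  assumes "\<And>p. p \<in> dual_functionals G \<Longrightarrow> \<bar>p \<bullet> v\<bar> \<le> c"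
  shows "hull_norm G v \<le> c"
  unfolding hull_norm_def by (rule cSUP_least[OF dual_functionals_nonempty assms])

text \<open>The unit vector \<open>sgn v\<close> is an admissible functional. Hence the new unit
  ball lies inside the Euclidean one, and by \<open>hull_norm_le_norm\<close> the two norms agree on
  \<open>G\<close>.\<close>

lemma norm_le_hull_norm: "norm v \<le> hull_norm G v"
proof -
  have "\<bar>sgn v \<bullet> v\<bar> \<le> hull_norm G v"
    by (intro hull_norm_upper unit_in_dual_functionals) (simp add: norm_sgn)
  moreover have "sgn v \<bullet> v = norm v"
    by (cases "v = 0") (simp_all add: sgn_div_norm dot_square_norm power2_eq_square)
  ultimately show ?thesis
    by simp
qed

lemma hull_norm_le_norm: "g \<in> G \<Longrightarrow> hull_norm G g \<le> norm g"
  by (rule hull_norm_least) (auto simp: dual_functionals_def)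

lemma hull_norm_scale_le: "hull_norm G (a *\<^sub>R v) \<le> \<bar>a\<bar> * hull_norm G v"
  by (rule hull_norm_least) (simp add: abs_mult mult_left_mono hull_norm_upper)

lemma is_norm_hull_norm: "is_norm (hull_norm G)"
  unfolding is_norm_def
proof (intro conjI allI)
  fix x y :: 'a and a :: real
  show "0 \<le> hull_norm G x"
    using norm_le_hull_norm norm_ge_zero order_trans by blast
  have zero: "hull_norm G 0 \<le> 0"
    by (rule hull_norm_least) simp
  then show "hull_norm G x = 0 \<longleftrightarrow> x = 0"
    using norm_le_hull_norm[of x G] norm_le_hull_norm[of 0 G] by auto
  show "hull_norm G (x + y) \<le> hull_norm G x + hull_norm G y"
  proof (rule hull_norm_least)
    fix p assume "p \<in> dual_functionals G"
    then have "\<bar>p \<bullet> x\<bar> \<le> hull_norm G x" "\<bar>p \<bullet> y\<bar> \<le> hull_norm G y"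
      by (rule hull_norm_upper)+
    then show "\<bar>p \<bullet> (x + y)\<bar> \<le> hull_norm G x + hull_norm G y"
      by (simp add: inner_add_right)
  qed
  show "hull_norm G (a *\<^sub>R x) = \<bar>a\<bar> * hull_norm G x"
  proof (cases "a = 0")
    case True
    then show ?thesis
      using zero norm_le_hull_norm[of 0 G] by simp
  next
    case False
    have "hull_norm G x \<le> \<bar>inverse a\<bar> * hull_norm G (a *\<^sub>R x)"
      using hull_norm_scale_le[of G "inverse a" "a *\<^sub>R x"] False by simp
    then have "\<bar>a\<bar> * hull_norm G x \<le> hull_norm G (a *\<^sub>R x)"
      using False by (simp add: field_simps)
    then show ?thesis
      using hull_norm_scale_le[of G a x] by linarith
  qed
qed

text \<open>A uniform margin in Cauchy-Schwarz over all of \<open>G\<close> lets the unit vector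
  along \<open>b\<close> be lengthened and remain admissible; its value at \<open>b\<close> then
  exceeds \<open>norm b\<close>.\<close>

lemma norm_less_hull_norm:
  assumes "b \<noteq> 0" "0 < e" "\<And>g. g \<in> G \<Longrightarrow> (1 + e) * \<bar>b \<bullet> g\<bar> \<le> norm b * norm g"
  shows "norm b < hull_norm G b"
proof -
  \<comment> \<open>The cap at 1 ensures \<open>norm p = 1 + e' \<le> 2\<close>.\<close>
  define e' where "e' = min e 1"
  define p where "p = ((1 + e') / norm b) *\<^sub>R b"
  have e': "0 < e'" "e' \<le> 1" "e' \<le> e"
    using assms(2) by (auto simp: e'_def)
  have "p \<in> dual_functionals G"
    unfolding dual_functionals_def
  proof (safe)
    show "norm p \<le> 2"
      using e' assms(1) by (simp add: p_def)
    fix g assume "g \<in> G"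
    have "(1 + e') * \<bar>b \<bullet> g\<bar> \<le> (1 + e) * \<bar>b \<bullet> g\<bar>"
      using e' by (intro mult_right_mono) auto
    also have "\<dots> \<le> norm b * norm g"
      using \<open>g \<in> G\<close> by (rule assms(3))
    finally show "\<bar>p \<bullet> g\<bar> \<le> norm g"
      using assms(1) e' by (simp add: p_def abs_mult pos_divide_le_eq mult.commute)
  qed
  then have "\<bar>p \<bullet> b\<bar> \<le> hull_norm G b"
    by (rule hull_norm_upper)
  moreover have "p \<bullet> b = (1 + e') * norm b"
    using assms(1) by (simp add: p_def dot_square_norm power2_eq_square)
  moreover have "norm b < (1 + e') * norm b"
    using e' assms(1) by simp
  ultimately show ?thesis
    by linarith
qed

section \<open>Uniform margins in Cauchy-Schwarz\<close>

lemma inner_gap_finite: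
  fixes b :: "'a::real_inner"
  assumes "finite F" "\<And>g. g \<in> F \<Longrightarrow> \<bar>b \<bullet> g\<bar> < norm b * norm g"
  shows "\<exists>e>0. \<forall>g\<in>F. (1 + e) * \<bar>b \<bullet> g\<bar> \<le> norm b * norm g"
  using assms
proof (induction F)
  case empty
  then show ?case
    by (auto intro: exI[of _ 1])
next
  case (insert h F)
  then obtain e where e: "e > 0" "\<forall>g\<in>F. (1 + e) * \<bar>b \<bullet> g\<bar> \<le> norm b * norm g"
    by auto
  have "\<exists>d>0. (1 + d) * \<bar>b \<bullet> h\<bar> \<le> norm b * norm h"
  proof (cases "b \<bullet> h = 0")
    case True
    then show ?thesis
      by (auto intro: exI[of _ 1])
  next
    case False
    then show ?thesis
      using insert.prems[of h]
      \<comment> \<open>The witness turns the inequality into an equality; strictness makes it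
        positive.\<close>
      by (intro exI[of _ "norm b * norm h / \<bar>b \<bullet> h\<bar> - 1"]) (auto simp: field_simps)
  qed
  then obtain d where d: "d > 0" "(1 + d) * \<bar>b \<bullet> h\<bar> \<le> norm b * norm h"
    by blast
  have "(1 + min d e) * \<bar>b \<bullet> g\<bar> \<le> norm b * norm g" if "g \<in> insert h F" for g
  proof -
    have "(1 + min d e) * \<bar>b \<bullet> g\<bar> \<le> (1 + d) * \<bar>b \<bullet> g\<bar>" "(1 + min d e) * \<bar>b \<bullet> g\<bar> \<le> (1 + e) * \<bar>b \<bullet> g\<bar>"
      by (intro mult_right_mono; simp)+
    then show ?thesis
      using that d e by (auto intro: order_trans)
  qed
  then show ?case
    using d e by (intro exI[of _ "min d e"]) auto
qed

text \<open>The angle between \<open>(1, s)\<close> and \<open>(1, t)\<close>, for distinct nonnegative integers \<open>s\<close> and \<open>t\<close>, is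
  bounded below in terms of \<open>s\<close> alone, since \<open>(1 + s\<^sup>2)(1 + t\<^sup>2) - (1 + s t)\<^sup>2 = (s - t)\<^sup>2\<close>.\<close>

lemma integer_slope_gap:
  fixes s :: nat
  shows "\<exists>e>0. \<forall>t. t \<noteq> s \<longrightarrow>
    (1 + e) * (1 + real s * real t) \<le> sqrt (1 + (real s)\<^sup>2) * sqrt (1 + (real t)\<^sup>2)"
proof -
  \<comment> \<open>Chosen so that \<open>1 + s * t \<le> M * \<bar>s - t\<bar>\<close>, where
    integrality supplies \<open>1 \<le> \<bar>s - t\<bar>\<close>. The next constant satisfies
    \<open>(1 + e)^2 = 1 + 1 / M^2\<close>.\<close>
  define M where "M = 1 + real s + (real s)\<^sup>2"
  define e where "e = sqrt (1 + 1 / M\<^sup>2) - 1"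
  have M: "M > 0"
    by (simp add: M_def add_pos_nonneg)
  have e: "e > 0"
    using M by (simp add: e_def)
  have "(1 + e) * (1 + real s * real t) \<le> sqrt (1 + (real s)\<^sup>2) * sqrt (1 + (real t)\<^sup>2)"
    if "t \<noteq> s" for t
  proof -
    define D where "D = \<bar>real s - real t\<bar>"
    have D: "1 \<le> D"
      using that by (simp add: D_def)
    have "real t \<le> real s + D"
      by (simp add: D_def)
    then have "real s * real t \<le> real s * (real s + D)"
      by (intro mult_left_mono) auto
    moreover have "(real s)\<^sup>2 * 1 \<le> (real s)\<^sup>2 * D"
      using D by (intro mult_left_mono) auto
    ultimately have le: "1 + real s * real t \<le> M * D"
      using D by (simp add: M_def algebra_simps power2_eq_square)
    have "(1 + real s * real t)\<^sup>2 \<le> (M * D)\<^sup>2"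
      using le by (intro power_mono) auto
    then have "(1 + real s * real t)\<^sup>2 / M\<^sup>2 \<le> D\<^sup>2"
      using M by (simp add: field_simps power_mult_distrib)
    also have "D\<^sup>2 = (1 + (real s)\<^sup>2) * (1 + (real t)\<^sup>2) - (1 + real s * real t)\<^sup>2"
      by (simp add: D_def power2_eq_square algebra_simps)
    finally have "(1 + 1 / M\<^sup>2) * (1 + real s * real t)\<^sup>2 \<le> (1 + (real s)\<^sup>2) * (1 + (real t)\<^sup>2)"
      by (simp add: algebra_simps)
    then have "sqrt ((1 + 1 / M\<^sup>2) * (1 + real s * real t)\<^sup>2) \<le> sqrt ((1 + (real s)\<^sup>2) * (1 + (real t)\<^sup>2))"
      by simp
    then show ?thesis
      by (simp add: e_def real_sqrt_mult)
  qed
  then show ?thesis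
    using e by blast
qed

section \<open>Circle points, axis centres and the shattering norm\<close>

lemma ex_norm_vc_dim_infinity:
  assumes "3 \<le> DIM('a::euclidean_space)"
  shows "\<exists>N :: 'a \<Rightarrow> real. is_norm N \<and> vc_dim (norm_cballs N) = \<infinity>"
proof -
  obtain E :: "'a set" where "E \<subseteq> Basis" "card E = 3"
    using assms obtain_subset_with_card_n by metis
  then obtain e1 e2 e3 :: 'a where B: "e1 \<in> Basis" "e2 \<in> Basis" "e3 \<in> Basis"
    and ne: "e1 \<noteq> e2" "e1 \<noteq> e3" "e2 \<noteq> e3"
    by (auto simp: card_3_iff)
  have ip [simp]: "e1 \<bullet> e1 = 1" "e2 \<bullet> e2 = 1" "e3 \<bullet> e3 = 1" "e1 \<bullet> e2 = 0" "e2 \<bullet> e1 = 0"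
    "e1 \<bullet> e3 = 0" "e2 \<bullet> e3 = 0" "e3 \<bullet> e1 = 0" "e3 \<bullet> e2 = 0"
    using B ne by (auto simp: inner_Basis)
  \<comment> \<open>Distinct first coordinates in \<open>(0, 1]\<close> give distinct unit vectors
    \<open>x j\<close>.\<close>
  define r where "r = (\<lambda>j::nat. 1 / (real j + 1))"
  define x where "x = (\<lambda>j. r j *\<^sub>R e1 + sqrt (1 - (r j)\<^sup>2) *\<^sub>R e2)"
  have r: "(r j)\<^sup>2 \<le> 1" for j
    by (simp add: r_def power_le_one)
  have xe3 [simp]: "x j \<bullet> e3 = 0" "e3 \<bullet> x j = 0" for j
    by (simp_all add: x_def inner_add_left inner_add_right)
  have xx [simp]: "x j \<bullet> x j = 1" for j
    using r[of j] by (simp add: x_def inner_add_left inner_add_right flip: power2_eq_square)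
  have "x j \<bullet> e1 = r j" for j
    by (simp add: x_def inner_add_left)
  then have injx: "inj x"
    by (intro injI) (metis r_def add_right_cancel inverse_eq_divide inverse_inverse_eq of_nat_eq_iff)
  \<comment> \<open>The vector from the centre \<open>- real (Suc m) *\<^sub>R e3\<close> to
    \<open>x j\<close>. Its length depends on \<open>m\<close> alone, and \<open>Suc\<close> makes
    its height positive, which excludes opposite vectors below.\<close>
  define v where "v = (\<lambda>j m. x j + real (Suc m) *\<^sub>R e3)"
  have inner_v: "v j m \<bullet> v k l = x j \<bullet> x k + real (Suc m) * real (Suc l)" for j m k l
    by (simp add: v_def inner_add_left inner_add_right del: of_nat_Suc)
  have norm_v: "norm (v j m) = sqrt (1 + (real (Suc m))\<^sup>2)" for j m
    by (simp add: norm_eq_sqrt_inner inner_v power2_eq_square del: of_nat_Suc)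
  have v_nz: "v j m \<noteq> 0" for j m
    using norm_v[of j m] by (metis norm_zero add_pos_nonneg real_sqrt_gt_zero less_irrefl zero_le_power2 zero_less_one)
  have v_strict: "\<bar>v j m \<bullet> v k m\<bar> < norm (v j m) * norm (v k m)" if "j \<noteq> k" for j k m
  proof -
    have "x j \<noteq> x k"
      using that injx by (simp add: inj_eq)
    have "v j m \<noteq> v k m"
      using \<open>x j \<noteq> x k\<close> by (simp add: v_def)
    have eq: "norm (v k m) = norm (v j m)"
      by (simp only: norm_v)
    have "v j m \<noteq> - v k m"
    proof
      assume "v j m = - v k m"
      then have "v j m \<bullet> e3 = - v k m \<bullet> e3"
        by simp
      then show False
        by (simp add: v_def inner_add_left inner_diff_left)
    qed
    have "\<bar>v j m \<bullet> v k m\<bar> \<noteq> norm (v j m) * norm (v k m)"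
    proof
      assume "\<bar>v j m \<bullet> v k m\<bar> = norm (v j m) * norm (v k m)"
      then have "norm (v j m) *\<^sub>R v k m = norm (v j m) *\<^sub>R v j m
          \<or> norm (v j m) *\<^sub>R v k m = norm (v j m) *\<^sub>R (- v j m)"
        using norm_cauchy_schwarz_abs_eq[of "v j m" "v k m"]
        by (simp only: eq scaleR_minus_left scaleR_minus_right simp_thms)
      then have "v k m = v j m \<or> v k m = - v j m"
        unfolding scaleR_cancel_left using v_nz[of j m] by (simp only: norm_eq_zero simp_thms)
      then show False
        using \<open>v j m \<noteq> v k m\<close> \<open>v j m \<noteq> - v k m\<close> minus_minus by metis
    qed
    then show ?thesis
      using Cauchy_Schwarz_ineq2[of "v j m" "v k m"] by linarith
  qed
  \<comment> \<open>The binary coding \<open>set_decode\<close> enumerates the finite index sets, so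
    one \<open>G\<close> serves all patterns at once.\<close>
  define G where "G = {v k l | k l. k \<in> set_decode l}"
  have N_iff: "hull_norm G (v j m) \<le> sqrt (1 + (real (Suc m))\<^sup>2) \<longleftrightarrow> j \<in> set_decode m" for j m
  proof (cases "j \<in> set_decode m")
    case True
    then have "v j m \<in> G"
      by (auto simp: G_def)
    from hull_norm_le_norm[OF this] True show ?thesis
      by (simp only: norm_v)
  next
    case False
    have "\<exists>e>0. \<forall>g\<in>(\<lambda>k. v k m) ` set_decode m. (1 + e) * \<bar>v j m \<bullet> g\<bar> \<le> norm (v j m) * norm g"
    proof (rule inner_gap_finite)
      show "finite ((\<lambda>k. v k m) ` set_decode m)"
        by simp
      fix g assume "g \<in> (\<lambda>k. v k m) ` set_decode m"
      then obtain k where "g = v k m" "k \<in> set_decode m"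
        by (rule imageE)
      then show "\<bar>v j m \<bullet> g\<bar> < norm (v j m) * norm g"
        using False v_strict[of j k m] by metis
    qed
    then obtain e where e: "e > 0" "\<And>g. g \<in> (\<lambda>k. v k m) ` set_decode m \<Longrightarrow>
        (1 + e) * \<bar>v j m \<bullet> g\<bar> \<le> norm (v j m) * norm g"
      by blast
    obtain e' where e': "e' > 0" "\<And>t. t \<noteq> Suc m \<Longrightarrow> (1 + e') * (1 + real (Suc m) * real t)
        \<le> sqrt (1 + (real (Suc m))\<^sup>2) * sqrt (1 + (real t)\<^sup>2)"
      using integer_slope_gap[of "Suc m"] by blast
    have "norm (v j m) < hull_norm G (v j m)"
    proof (rule norm_less_hull_norm[OF v_nz])
      show "0 < min e e'"
        using e e' by simp
      fix g assume "g \<in> G"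
      then obtain k l where g: "g = v k l" "k \<in> set_decode l"
        by (auto simp: G_def)
      show "(1 + min e e') * \<bar>v j m \<bullet> g\<bar> \<le> norm (v j m) * norm g"
      \<comment> \<open>Directions from the same centre are finitely many and have the margin
        \<open>e\<close>; those from other centres share the margin \<open>e'\<close> of the integer
        slopes.\<close>
      proof (cases "l = m")
        case True
        have "(1 + min e e') * \<bar>v j m \<bullet> g\<bar> \<le> (1 + e) * \<bar>v j m \<bullet> g\<bar>"
          by (intro mult_right_mono) auto
        also have "\<dots> \<le> norm (v j m) * norm g"
          using e(2) g True by blast
        finally show ?thesis .
      next
        case False
        \<comment> \<open>This crude bound reduces the inner product to that of
          \<open>(1, Suc m)\<close> and \<open>(1, Suc l)\<close>.\<close>
        have "\<bar>x j \<bullet> x k\<bar> \<le> 1"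
          using Cauchy_Schwarz_ineq2[of "x j" "x k"] by (simp add: norm_eq_sqrt_inner)
        then have "\<bar>v j m \<bullet> g\<bar> \<le> 1 + real (Suc m) * real (Suc l)"
          unfolding g inner_v by (intro order_trans[OF abs_triangle_ineq]) (simp del: of_nat_Suc)
        then have "(1 + min e e') * \<bar>v j m \<bullet> g\<bar> \<le> (1 + e') * (1 + real (Suc m) * real (Suc l))"
          using e e' by (intro mult_mono) auto
        also have "\<dots> \<le> norm (v j m) * norm g"
          unfolding g norm_v using e'(2)[of "Suc l"] False by simp
        finally show ?thesis .
      qed
    qed
    then show ?thesis
      using False by (simp add: norm_v del: of_nat_Suc)
  qed
  have "vc_dim (norm_cballs (hull_norm G)) = \<infinity>"
  proof (rule vc_dim_eq_infinityI)
    fix n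
    have "shatters (norm_cballs (hull_norm G)) (x ` {..<n})"
      unfolding shatters_def
    proof (intro allI impI)
      fix A assume "A \<subseteq> x ` {..<n}"
      then obtain J where J: "J \<subseteq> {..<n}" "A = x ` J"
        by (auto simp: subset_image_iff)
      define m where "m = set_encode J"
      have dec: "set_decode m = J"
        using finite_subset[OF J(1)] by (simp add: m_def)
      \<comment> \<open>The radius is the common Euclidean length of all \<open>v j m\<close>, so
        \<open>N_iff\<close> decides membership.\<close>
      define K where "K = norm_cball (hull_norm G) (- real (Suc m) *\<^sub>R e3) (sqrt (1 + (real (Suc m))\<^sup>2))"
      have "K \<in> norm_cballs (hull_norm G)"
      proof -
        have "0 < sqrt (1 + (real (Suc m))\<^sup>2)"
          by (simp add: add_pos_nonneg)
        then show ?thesis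
          unfolding K_def norm_cballs_def by blast
      qed
      moreover have "x j \<in> K \<longleftrightarrow> j \<in> J" for j
        using N_iff[of j m] dec by (simp add: K_def norm_cball_def v_def del: of_nat_Suc)
      then have "x ` {..<n} \<inter> K = A"
        using J by auto
      ultimately show "\<exists>K\<in>norm_cballs (hull_norm G). x ` {..<n} \<inter> K = A"
        by blast
    qed
    moreover have "card (x ` {..<n}) = n"
      using card_image[OF inj_on_subset[OF injx subset_UNIV], of "{..<n}"] by simp
    ultimately show "\<exists>S. finite S \<and> card S = n \<and> shatters (norm_cballs (hull_norm G)) S"
      by blast
  qed
  then show ?thesis
    using is_norm_hull_norm by blast
qed

theorem theorem8:
  fixes d :: nat
  assumes "2 \<le> d"
    and "CARD('n::finite) = d"
    and "CARD('m::finite) = d - 1"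
    and "vc_dim {K :: (real ^ 'm) set. convex_body K} = \<infinity>"
  shows "\<exists>N :: real ^ 'n \<Rightarrow> real. is_norm N \<and> vc_dim (norm_cballs N) = \<infinity>"
proof (rule ex_norm_vc_dim_infinity)
  obtain S :: "(real ^ 'm) set" where S: "finite S" "2 < card S" "shatters {K. convex_body K} S"
    using vc_dim_infinityD[OF assms(4)] by blast
  \<comment> \<open>A line shatters at most two points by convex sets; with \<open>2 \<le> d\<close>
    this leaves \<open>3 \<le> d\<close>.\<close>
  have "CARD('m) \<noteq> 1"
    using shatters_convex_CARD_1[of "{K. convex_body K}" S] S by (auto simp: convex_body_def)
  then show "3 \<le> DIM(real ^ 'n)"
    using assms(1-3) by simp
qed

end
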